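(* Let $\mathcal M$ be a smooth manifold (of even or odd dimension) with $\dim\mathcal M\geq 6$, and let $\omega$ be a smooth $2$-form of maximal rank on $\mathcal M$ such that $d\omega = \beta\wedge\omega$ for some smooth $1$-form $\beta$ on $\mathcal M$. Then $\beta$ is closed, i.e. $d\beta = 0$.
   Context: A $2$-form $\omega$ on a manifold $\mathcal M$ is of maximal rank if at every point $q\in\mathcal M$ the kernel $\{x\in T_q\mathcal M : \iota_x\omega_q = 0\}$ is trivial (when $\dim \mathcal M$ is even) or one-dimensional (when $\dim\mathcal M$ is odd). *)

theory Defs
  imports "HOL-Analysis.Analysis"
begin

primrec Ck_on :: "nat \<Rightarrow> 'e::euclidean_space set \<Rightarrow> ('e \<Rightarrow> 'f::real_normed_vector) \<Rightarrow> bool" where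
  "Ck_on 0 S f \<longleftrightarrow> continuous_on S f"
| "Ck_on (Suc k) S f \<longleftrightarrow>
     (\<forall>x\<in>S. f differentiable (at x)) \<and> (\<forall>v. Ck_on k S (\<lambda>x. frechet_derivative f (at x) v))"

definition smooth_on :: "'e::euclidean_space set \<Rightarrow> ('e \<Rightarrow> 'f::real_normed_vector) \<Rightarrow> bool" where
  "smooth_on S f \<longleftrightarrow> (\<forall>k. Ck_on k S f)"

text \<open>
  The carrier of the manifold is the topological space \<open>M\<close>; the dimension is the dimension of the
  model space \<open>'e\<close>. The values of a coordinate map outside its domain are irrelevant.
\<close>

datatype ('a, 'e) chart = Chart (chart_dom: "'a set") (chart_map: "'a \<Rightarrow> 'e")

definition chart_inv :: "('a, 'e) chart \<Rightarrow> 'e \<Rightarrow> 'a" where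
  "chart_inv c = inv_into (chart_dom c) (chart_map c)"

definition chart_on :: "'a topology \<Rightarrow> ('a, 'e::euclidean_space) chart \<Rightarrow> bool" where
  "chart_on M c \<longleftrightarrow>
     openin M (chart_dom c) \<and>
     open (chart_map c ` chart_dom c) \<and>
     homeomorphic_map (subtopology M (chart_dom c))
       (top_of_set (chart_map c ` chart_dom c)) (chart_map c)"

definition transition :: "('a, 'e) chart \<Rightarrow> ('a, 'e) chart \<Rightarrow> 'e \<Rightarrow> 'e" where
  "transition c c' = chart_map c' \<circ> chart_inv c"

definition smooth_manifold :: "'a topology \<Rightarrow> ('a, 'e::euclidean_space) chart set \<Rightarrow> bool" where
  "smooth_manifold M A \<longleftrightarrow>
     Hausdorff_space M \<and> second_countable M \<and>
     (\<forall>c\<in>A. chart_on M c) \<and>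
     (\<Union>c\<in>A. chart_dom c) = topspace M \<and>
     (\<forall>c\<in>A. \<forall>c'\<in>A. smooth_on (chart_map c ` (chart_dom c \<inter> chart_dom c')) (transition c c'))"

definition charts_at :: "('a, 'e) chart set \<Rightarrow> 'a \<Rightarrow> ('a, 'e) chart set" where
  "charts_at A q = {c\<in>A. q \<in> chart_dom c}"

text \<open>
  A tangent vector at \<open>q\<close> is the family of its coordinate vectors in all charts around \<open>q\<close>,
  related to each other by the differentials of the transition maps. It is extended by \<open>0\<close> to
  the remaining charts, so that equality of tangent vectors is equality of functions; the vector
  space operations are pointwise.
\<close>

type_synonym ('a, 'e) tangent = "('a, 'e) chart \<Rightarrow> 'e"

definition tangent_space ::
    "('a, 'e::euclidean_space) chart set \<Rightarrow> 'a \<Rightarrow> ('a, 'e) tangent set" where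
  "tangent_space A q =
     {X. (\<forall>c\<in>charts_at A q. \<forall>c'\<in>charts_at A q.
            X c' = frechet_derivative (transition c c') (at (chart_map c q)) (X c)) \<and>
         (\<forall>c. c \<notin> charts_at A q \<longrightarrow> X c = 0)}"

definition tangent_of ::
    "('a, 'e::euclidean_space) chart set \<Rightarrow> ('a, 'e) chart \<Rightarrow> 'a \<Rightarrow> 'e \<Rightarrow> ('a, 'e) tangent" where
  "tangent_of A c q v =
     (\<lambda>c'. if c' \<in> charts_at A q
           then frechet_derivative (transition c c') (at (chart_map c q)) v else 0)"

text \<open>
  A \<open>k\<close>-form maps a point and a list of \<open>k\<close> tangent vectors at that point to a real number.
  Values at any other arguments are irrelevant and are ignored by \<open>form_eq\<close>.
\<close>

type_synonym ('a, 'e) form = "'a \<Rightarrow> ('a, 'e) tangent list \<Rightarrow> real"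

definition tangent_lists ::
    "('a, 'e::euclidean_space) chart set \<Rightarrow> nat \<Rightarrow> 'a \<Rightarrow> ('a, 'e) tangent list set" where
  "tangent_lists A k q = {Xs. length Xs = k \<and> set Xs \<subseteq> tangent_space A q}"

definition form_eq ::
    "'a topology \<Rightarrow> ('a, 'e::euclidean_space) chart set \<Rightarrow> nat \<Rightarrow>
     ('a, 'e) form \<Rightarrow> ('a, 'e) form \<Rightarrow> bool" where
  "form_eq M A k \<eta> \<theta> \<longleftrightarrow> (\<forall>q\<in>topspace M. \<forall>Xs\<in>tangent_lists A k q. \<eta> q Xs = \<theta> q Xs)"

definition multilinear_at ::
    "('a, 'e::euclidean_space) chart set \<Rightarrow> nat \<Rightarrow> 'a \<Rightarrow> (('a, 'e) tangent list \<Rightarrow> real) \<Rightarrow> bool" where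
  "multilinear_at A k q f \<longleftrightarrow>
     (\<forall>Xs\<in>tangent_lists A k q. \<forall>i<k. \<forall>X\<in>tangent_space A q. \<forall>Y\<in>tangent_space A q. \<forall>a b.
        f (Xs[i := (\<lambda>c. a *\<^sub>R X c + b *\<^sub>R Y c)]) = a * f (Xs[i := X]) + b * f (Xs[i := Y]))"

definition alternating_at ::
    "('a, 'e::euclidean_space) chart set \<Rightarrow> nat \<Rightarrow> 'a \<Rightarrow> (('a, 'e) tangent list \<Rightarrow> real) \<Rightarrow> bool" where
  "alternating_at A k q f \<longleftrightarrow>
     (\<forall>Xs\<in>tangent_lists A k q. (\<exists>i<k. \<exists>j<k. i \<noteq> j \<and> Xs ! i = Xs ! j) \<longrightarrow> f Xs = 0)"

definition local_form ::
    "('a, 'e::euclidean_space) chart set \<Rightarrow> ('a, 'e) chart \<Rightarrow> ('a, 'e) form \<Rightarrow>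
     'e \<Rightarrow> 'e list \<Rightarrow> real" where
  "local_form A c \<omega> x vs = \<omega> (chart_inv c x) (map (tangent_of A c (chart_inv c x)) vs)"

definition smooth_form ::
    "'a topology \<Rightarrow> ('a, 'e::euclidean_space) chart set \<Rightarrow> nat \<Rightarrow> ('a, 'e) form \<Rightarrow> bool" where
  "smooth_form M A k \<omega> \<longleftrightarrow>
     (\<forall>q\<in>topspace M. multilinear_at A k q (\<omega> q) \<and> alternating_at A k q (\<omega> q)) \<and>
     (\<forall>c\<in>A. \<forall>vs. length vs = k \<longrightarrow>
        smooth_on (chart_map c ` chart_dom c) (\<lambda>x. local_form A c \<omega> x vs))"

text \<open>
  Wedge product of a \<open>k\<close>-form and an \<open>l\<close>-form, in the normalisation
  \<open>(\<eta> \<and> \<theta>)(X\<^sub>1, X\<^sub>2) = \<eta>(X\<^sub>1) \<theta>(X\<^sub>2) - \<eta>(X\<^sub>2) \<theta>(X\<^sub>1)\<close> for 1-forms. This is the one that goes with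
  an exterior derivative without a factor \<open>1 / (k + 1)\<close>.
\<close>

definition wedge :: "nat \<Rightarrow> nat \<Rightarrow> ('a, 'e) form \<Rightarrow> ('a, 'e) form \<Rightarrow> ('a, 'e) form" where
  "wedge k l \<eta> \<theta> q Xs =
     (\<Sum>\<sigma> | \<sigma> permutes {..<k + l}.
        of_int (sign \<sigma>) * \<eta> q (map (\<lambda>i. Xs ! \<sigma> i) [0..<k]) *
          \<theta> q (map (\<lambda>i. Xs ! \<sigma> i) [k..<k + l])) / (fact k * fact l)"

text \<open>
  Invariant formula for the exterior derivative on an open subset of \<open>'e\<close>, evaluated on constant
  vector fields; the bracket terms vanish.
\<close>

definition flat_ext_deriv ::
    "('e::euclidean_space \<Rightarrow> 'e list \<Rightarrow> real) \<Rightarrow> 'e \<Rightarrow> 'e list \<Rightarrow> real" where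
  "flat_ext_deriv f x vs =
     (\<Sum>i<length vs. (-1) ^ i *
        frechet_derivative (\<lambda>y. f y (take i vs @ drop (Suc i) vs)) (at x) (vs ! i))"

text \<open>
  The exterior derivative is computed in a chart around the point; for smooth forms the result
  does not depend on the chart.
\<close>

definition ext_deriv ::
    "('a, 'e::euclidean_space) chart set \<Rightarrow> ('a, 'e) form \<Rightarrow> ('a, 'e) form" where
  "ext_deriv A \<omega> q Xs =
     (let c = (SOME c. c \<in> charts_at A q)
      in flat_ext_deriv (local_form A c \<omega>) (chart_map c q) (map (\<lambda>X. X c) Xs))"

definition closed_form ::
    "'a topology \<Rightarrow> ('a, 'e::euclidean_space) chart set \<Rightarrow> nat \<Rightarrow> ('a, 'e) form \<Rightarrow> bool" where
  "closed_form M A k \<omega> \<longleftrightarrow> form_eq M A (Suc k) (ext_deriv A \<omega>) (\<lambda>_ _. 0)"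

definition form_kernel ::
    "('a, 'e::euclidean_space) chart set \<Rightarrow> ('a, 'e) form \<Rightarrow> 'a \<Rightarrow> ('a, 'e) tangent set" where
  "form_kernel A \<omega> q = {X\<in>tangent_space A q. \<forall>Y\<in>tangent_space A q. \<omega> q [X, Y] = 0}"

definition maximal_rank ::
    "'a topology \<Rightarrow> ('a, 'e::euclidean_space) chart set \<Rightarrow> ('a, 'e) form \<Rightarrow> bool" where
  "maximal_rank M A \<omega> \<longleftrightarrow>
     (\<forall>q\<in>topspace M.
        if even DIM('e) then form_kernel A \<omega> q = {\<lambda>c. 0}
        else (\<exists>X. X \<noteq> (\<lambda>c. 0) \<and> form_kernel A \<omega> q = range (\<lambda>a c. a *\<^sub>R X c)))"

end

theory Submission
  imports Defs
begin

text \<open>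
  From \<open>0 = d(d\<omega>) = d\<beta> \<and> \<omega> - \<beta> \<and> d\<omega>\<close> and \<open>\<beta> \<and> d\<omega> = \<beta> \<and> \<beta> \<and> \<omega> = 0\<close> one gets \<open>\<eta> \<and> \<omega> = 0\<close> for
  \<open>\<eta> = d\<beta>\<close>. Since \<open>\<omega>\<close> has rank at least 6, any two vectors \<open>u\<close>, \<open>v\<close> have vectors \<open>x\<close>, \<open>y\<close> in their
  common \<open>\<omega>\<close>-orthogonal complement with \<open>\<omega>(x, y) = 1\<close>, and \<open>(\<eta> \<and> \<omega>)(u, v, x, y) = 0\<close> becomes
  \<open>\<eta>(u, v) + \<eta>(x, y) \<omega>(u, v) = 0\<close>. So \<open>\<eta>\<close> vanishes on all \<open>\<omega>\<close>-orthogonal pairs. If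
  \<open>\<omega>(u, v) = 1\<close>, this applies to the pair \<open>u + x\<close>, \<open>v - y\<close> and yields \<open>\<eta>(u, v) = \<eta>(x, y)\<close>, so
  \<open>\<eta>(u, v) = 0\<close> too.

  The chart used by \<open>ext_deriv\<close> may vary wildly with the point. To differentiate \<open>d\<omega> = \<beta> \<and> \<omega>\<close>
  in a single chart, one first needs that \<open>d\<omega>\<close> does not depend on the chart.
\<close>

subsection \<open>Linear algebra of 2-forms\<close>

text \<open>Reduces a family of bilinear forms to its finitely many coefficient functions, so that
  it can be differentiated one coefficient at a time.\<close>

lemma bilinear_expand:
  fixes h :: "'a::euclidean_space \<Rightarrow> 'b::euclidean_space \<Rightarrow> real"
  assumes "bilinear h"
  shows "h a b = (\<Sum>i\<in>Basis. \<Sum>j\<in>Basis. (a \<bullet> i) * (b \<bullet> j) * h i j)"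
proof -
  have "h a b = h (\<Sum>i\<in>Basis. (a \<bullet> i) *\<^sub>R i) (\<Sum>j\<in>Basis. (b \<bullet> j) *\<^sub>R j)"
    by (simp add: euclidean_representation)
  also have "\<dots> = (\<Sum>(i, j)\<in>Basis \<times> Basis. h ((a \<bullet> i) *\<^sub>R i) ((b \<bullet> j) *\<^sub>R j))"
    by (rule bilinear_sum[OF assms])
  also have "\<dots> = (\<Sum>i\<in>Basis. \<Sum>j\<in>Basis. (a \<bullet> i) * (b \<bullet> j) * h i j)"
    by (simp add: sum.cartesian_product bilinear_lmul[OF assms] bilinear_rmul[OF assms] mult.left_commute mult.assoc)
  finally show ?thesis .
qed

lemma two_form_orthogonal_pair:
  fixes w :: "'e::euclidean_space \<Rightarrow> 'e \<Rightarrow> real"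
  assumes dim: "DIM('e) \<ge> 6" and bil: "bilinear w"
    and ker: "{x. \<forall>y. w x y = 0} \<subseteq> span {z}"
  obtains x y where "w u x = 0" "w v x = 0" "w u y = 0" "w v y = 0" "w x y = 1"
proof -
  \<comment> \<open>If \<open>w\<close> vanished on \<open>W = {T u, T v}\<^sup>\<bottom>\<close>, then \<open>T\<close> would map \<open>W \<inter> z\<^sup>\<bottom>\<close>, of dimension at
    least 3, injectively into \<open>span {T u, T v}\<close>.\<close>
  define T where "T x = (\<Sum>b\<in>Basis. w x b *\<^sub>R b)" for x
  have lin: "linear (\<lambda>x. w x y)" "linear (w x)" for x y
    using bil by (auto simp: bilinear_def)
  have T: "T x \<bullet> y = w x y" for x y
  proof -
    have "T x \<bullet> y = (\<Sum>b\<in>Basis. (y \<bullet> b) *\<^sub>R w x b)"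
      by (simp add: T_def inner_sum_left inner_commute[of y] mult.commute)
    also have "\<dots> = w x (\<Sum>b\<in>Basis. (y \<bullet> b) *\<^sub>R b)"
      by (simp add: linear_sum[OF lin(2)] linear_scale[OF lin(2)])
    finally show ?thesis by (simp add: euclidean_representation)
  qed
  have linT: "linear T"
    by (rule linearI) (simp_all add: T_def bilinear_ladd[OF bil] bilinear_lmul[OF bil] scaleR_left_distrib sum.distrib scaleR_sum_right)
  define S where "S = span {T u, T v}"
  define W where "W = orthogonal_comp S"
  define W' where "W' = {y \<in> UNIV. \<forall>x\<in>span {T u, T v, z}. orthogonal x y}"
  have "dim W' + dim (span {T u, T v, z}) = dim (UNIV :: 'e set)"
    unfolding W'_def by (rule dim_subspace_orthogonal_to_vectors) auto
  moreover have "dim (span {T u, T v, z}) \<le> 3"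
    using dim_le_card[of "span {T u, T v, z}" "{T u, T v, z}"] card_length[of "[T u, T v, z]"]
    by (simp add: dim_span)
  ultimately have W'3: "dim W' \<ge> 3"
    using dim by simp
  have sub': "subspace W'"
    unfolding W'_def by (auto simp: subspace_def orthogonal_def inner_right_distrib)
  have W'z: "z \<bullet> y = 0" "y \<in> W" if "y \<in> W'" for y
  proof -
    show "z \<bullet> y = 0"
      using that by (auto simp: W'_def orthogonal_def intro: span_base)
    have "S \<subseteq> span {T u, T v, z}"
      unfolding S_def by (rule span_mono) auto
    then show "y \<in> W"
      using that by (auto simp: W'_def W_def orthogonal_comp_def)
  qed
  have "inj_on T (span W')"
  proof -
    have "x = 0" if "x \<in> W'" "T x = 0" for x
    proof -
      have "w x y = 0" for y
        using T[of x y] that(2) by simp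
      then have "x \<in> span {z}" using ker by auto
      then obtain k where "x = k *\<^sub>R z" by (auto simp: span_singleton)
      then have "x \<bullet> x = 0"
        using W'z(1)[OF that(1)] by (simp add: inner_commute)
      then show ?thesis by simp
    qed
    then have "inj_on T W'"
      using linear_injective_on_subspace_0[OF linT sub'] by blast
    then show ?thesis
      using sub' by (metis span_eq_iff)
  qed
  then have "dim (T ` W') \<ge> 3"
    using dim_image_eq[OF linT] W'3 by simp
  moreover have "dim S \<le> 2"
    unfolding S_def
    using dim_le_card[of "span {T u, T v}" "{T u, T v}"] card_length[of "[T u, T v]"]
    by (simp add: dim_span)
  ultimately have "\<not> T ` W' \<subseteq> S"
    using dim_subset[of "T ` W'" S] by linarith
  \<comment> \<open>\<open>S\<close> is a subspace and hence its own double orthogonal complement.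
    So \<open>T x\<close> outside \<open>S\<close> fails to be orthogonal to some \<open>y\<close>
    in \<open>W\<close>, which says \<open>w x y \<noteq> 0\<close>.\<close>
  then obtain x where x: "x \<in> W'" "T x \<notin> orthogonal_comp W"
    using orthogonal_comp_self[of S] by (auto simp: W_def S_def)
  then obtain y where y: "y \<in> W" "w x y \<noteq> 0"
    by (auto simp: orthogonal_comp_def orthogonal_def T[symmetric] inner_commute)
  have perp: "w u a = 0" "w v a = 0" if "a \<in> W" for a
    using that unfolding W_def S_def orthogonal_comp_def orthogonal_def T[symmetric]
    by (auto intro: span_base)
  show ?thesis
    by (rule that[of x "(1 / w x y) *\<^sub>R y"])
      (use perp[OF W'z(2)[OF x(1)]] perp[OF y(1)] y(2) in \<open>auto simp: bilinear_rmul[OF bil]\<close>)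
qed

text \<open>The hypothesis \<open>wedge\<close> is the expansion of \<open>e\<close> \<and>
  \<open>w\<close> = 0 on four vectors. One vector \<open>z\<close> serves both parities: in the
  application it is 0 in even dimension and spans the kernel of \<open>w\<close> in odd
  dimension.\<close>

lemma wedge_two_form_cancel:
  fixes w e :: "'e::euclidean_space \<Rightarrow> 'e \<Rightarrow> real"
  assumes dim: "DIM('e) \<ge> 6" and bil: "bilinear w" and alt: "\<And>x. w x x = 0"
    and ker: "{x. \<forall>y. w x y = 0} \<subseteq> span {z}"
    and e: "bilinear e"
    and wedge: "\<And>a b c d. e a b * w c d - e a c * w b d + e a d * w b c
                  + e b c * w a d - e b d * w a c + e c d * w a b = 0"
  shows "e u v = 0"
proof -
  have anti: "w x y = - w y x" for x y
    using alt[of "x + y"] alt[of x] alt[of y]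
    by (simp add: bilinear_ladd[OF bil] bilinear_radd[OF bil])
  have isotropic: "e a b = 0" if ab: "w a b = 0" for a b
  proof -
    obtain x y where "w a x = 0" "w b x = 0" "w a y = 0" "w b y = 0" "w x y = 1"
      using two_form_orthogonal_pair[OF dim bil ker] by blast
    then show ?thesis
      using wedge[of a b x y] ab by simp
  qed
  show ?thesis
  proof (cases "w u v = 0")
    case False
    \<comment> \<open>Normalising makes \<open>w u v'\<close> cancel against
      \<open>w x y = 1\<close> in \<open>w (u + x) (v' - y)\<close>. Since \<open>e\<close> is
      bilinear, the rescaling can be undone at the end.\<close>
    define v' where "v' = (1 / w u v) *\<^sub>R v"
    have uv': "w u v' = 1"
      using False by (simp add: v'_def bilinear_rmul[OF bil])
    obtain x y where xy: "w u x = 0" "w v' x = 0" "w u y = 0" "w v' y = 0" "w x y = 1"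
      using two_form_orthogonal_pair[OF dim bil ker] by blast
    have "w (u + x) (v' - y) = 0"
      using xy uv' anti[of x v'] by (simp add: bilinear_ladd[OF bil] bilinear_rsub[OF bil])
    then have "e (u + x) (v' - y) = 0" by (rule isotropic)
    moreover have "e u y = 0" "e x v' = 0"
      using xy anti[of x v'] by (auto intro!: isotropic)
    \<comment> \<open>The isotropic pair gives \<open>e u v' = e x y\<close>, while the wedge
      identity on \<open>u\<close>, \<open>v'\<close>, \<open>x\<close>, \<open>y\<close> gives the
      opposite sign.\<close>
    ultimately have "e u v' = e x y"
      by (simp add: bilinear_ladd[OF e] bilinear_rsub[OF e])
    moreover have "e u v' + e x y = 0"
      using wedge[of u v' x y] xy uv' by simp
    ultimately have "e u v' = 0" by simp
    then show ?thesis
      using False by (simp add: v'_def bilinear_rmul[OF e])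
  qed (rule isotropic)
qed

subsection \<open>Symmetry of second derivatives\<close>

text \<open>Pairing with \<open>b\<close> produces a real function of one real variable, to which
  the mean value theorem applies; for vector-valued functions the theorem fails.\<close>

lemma has_real_derivative_along_line:
  fixes f :: "'e::euclidean_space \<Rightarrow> 'f::euclidean_space"
  assumes "f differentiable (at (p + s *\<^sub>R v))"
  shows "((\<lambda>s. f (p + s *\<^sub>R v) \<bullet> b) has_real_derivative
           frechet_derivative f (at (p + s *\<^sub>R v)) v \<bullet> b) (at s)"
proof -
  let ?D = "frechet_derivative f (at (p + s *\<^sub>R v))"
  have D: "(f has_derivative ?D) (at (p + s *\<^sub>R v))"
    using assms by (simp add: frechet_derivative_works)
  have "((\<lambda>s. p + s *\<^sub>R v) has_derivative (\<lambda>h. h *\<^sub>R v)) (at s)"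
    by (auto intro!: derivative_eq_intros)
  from has_derivative_inner_left[OF has_derivative_compose[OF this D]]
  have "((\<lambda>s. f (p + s *\<^sub>R v) \<bullet> b) has_derivative (\<lambda>h. ?D (h *\<^sub>R v) \<bullet> b)) (at s)" .
  moreover have "(\<lambda>h. ?D (h *\<^sub>R v) \<bullet> b) = (*) (?D v \<bullet> b)"
    using linear_scale[OF linear_frechet_derivative[OF assms]] by (auto simp: fun_eq_iff)
  ultimately show ?thesis
    by (simp add: has_field_derivative_def)
qed

text \<open>The mean value theorem is applied twice: in direction \<open>v\<close> to the difference
  of \<open>f\<close> along two opposite sides of the parallelogram, then in direction
  \<open>w\<close> to the resulting derivative.\<close>

lemma second_difference_mean_value:
  fixes f :: "'e::euclidean_space \<Rightarrow> 'f::euclidean_space"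
  assumes "h > 0"
    and S: "\<And>s t. s \<in> {0..h} \<Longrightarrow> t \<in> {0..h} \<Longrightarrow> x + s *\<^sub>R v + t *\<^sub>R w \<in> S"
    and f: "\<And>y. y \<in> S \<Longrightarrow> f differentiable (at y)"
    and f': "\<And>y. y \<in> S \<Longrightarrow> (\<lambda>y. frechet_derivative f (at y) v) differentiable (at y)"
  obtains s t where "s \<in> {0..h}" "t \<in> {0..h}"
    "(f (x + h *\<^sub>R v + h *\<^sub>R w) - f (x + h *\<^sub>R v) - f (x + h *\<^sub>R w) + f x) \<bullet> b =
       h * h * (frechet_derivative (\<lambda>y. frechet_derivative f (at y) v)
                 (at (x + s *\<^sub>R v + t *\<^sub>R w)) w \<bullet> b)"
proof -
  let ?D = "\<lambda>y. frechet_derivative f (at y) v"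
  let ?F = "\<lambda>s. f ((x + h *\<^sub>R w) + s *\<^sub>R v) \<bullet> b - f (x + s *\<^sub>R v) \<bullet> b"
  have "(?F has_real_derivative ?D ((x + h *\<^sub>R w) + s *\<^sub>R v) \<bullet> b - ?D (x + s *\<^sub>R v) \<bullet> b) (at s)"
    if "0 \<le> s" "s \<le> h" for s
    using S[of s h] S[of s 0] that \<open>h > 0\<close>
    by (intro DERIV_diff has_real_derivative_along_line f) (auto simp: algebra_simps)
  from MVT2[OF \<open>h > 0\<close> this]
  obtain s where s: "0 < s" "s < h"
    "?F h - ?F 0 = h * (?D ((x + h *\<^sub>R w) + s *\<^sub>R v) \<bullet> b - ?D (x + s *\<^sub>R v) \<bullet> b)"
    by auto
  have "((\<lambda>t. ?D ((x + s *\<^sub>R v) + t *\<^sub>R w) \<bullet> b) has_real_derivative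
      frechet_derivative ?D (at ((x + s *\<^sub>R v) + t *\<^sub>R w)) w \<bullet> b) (at t)"
    if "0 \<le> t" "t \<le> h" for t
    using S[of s t] that s by (intro has_real_derivative_along_line f') auto
  from MVT2[OF \<open>h > 0\<close> this]
  obtain t where t: "0 < t" "t < h"
    "?D (x + s *\<^sub>R v + h *\<^sub>R w) \<bullet> b - ?D (x + s *\<^sub>R v) \<bullet> b =
       h * (frechet_derivative ?D (at ((x + s *\<^sub>R v) + t *\<^sub>R w)) w \<bullet> b)"
    by auto
  have "(f (x + h *\<^sub>R v + h *\<^sub>R w) - f (x + h *\<^sub>R v) - f (x + h *\<^sub>R w) + f x) \<bullet> b = ?F h - ?F 0"
    by (simp add: algebra_simps inner_diff_left inner_add_left)
  also have "\<dots> = h * h * (frechet_derivative ?D (at (x + s *\<^sub>R v + t *\<^sub>R w)) w \<bullet> b)"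
    using s(3) t(3) by (simp add: algebra_simps)
  finally show ?thesis
    using s t by (intro that[of s t]) auto
qed

lemma Ck_on_2D:
  assumes "Ck_on 2 S f" "y \<in> S"
  shows "f differentiable (at y)" "(\<lambda>y. frechet_derivative f (at y) v) differentiable (at y)"
    "continuous_on S (\<lambda>y. frechet_derivative (\<lambda>y. frechet_derivative f (at y) v) (at y) w)"
  using assms by (auto simp: eval_nat_numeral)

text \<open>Schwarz's theorem. The second difference of \<open>f\<close> over a small parallelogram
  does not change when \<open>v\<close> and \<open>w\<close> are exchanged, and divided by
  \<open>h * h\<close> it is a value of either mixed derivative at a nearby point. Continuity of
  these derivatives at \<open>x\<close> does the rest.\<close>

lemma second_derivative_symmetric:
  fixes f :: "'e::euclidean_space \<Rightarrow> 'f::euclidean_space"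
  assumes "open S" "x \<in> S" and f: "Ck_on 2 S f"
  shows "frechet_derivative (\<lambda>y. frechet_derivative f (at y) v) (at x) w =
         frechet_derivative (\<lambda>y. frechet_derivative f (at y) w) (at x) v"
proof (rule euclidean_eqI)
  fix b :: 'f
  define P where "P v w y = frechet_derivative (\<lambda>y. frechet_derivative f (at y) v) (at y) w \<bullet> b"
    for v w y
  have "isCont (P v w) x" for v w
    using Ck_on_2D(3)[OF f \<open>x \<in> S\<close>, of v w] \<open>open S\<close> \<open>x \<in> S\<close> unfolding P_def
    by (intro continuous_intros) (simp add: continuous_on_eq_continuous_at)
  have "\<bar>P v w x - P w v x\<bar> < e" if "e > 0" for e
  proof -
    have near: "\<forall>\<^sub>F y in nhds x. dist (P v w y) (P v w x) < e / 2" for v w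
      using \<open>isCont (P v w) x\<close> \<open>e > 0\<close>
      unfolding isCont_def tendsto_at_iff_tendsto_nhds by (intro tendstoD) auto
    have "\<forall>\<^sub>F y in nhds x. y \<in> S \<and> dist (P v w y) (P v w x) < e / 2 \<and> dist (P w v y) (P w v x) < e / 2"
      using near[of v w] near[of w v] eventually_nhds_in_open[OF \<open>open S\<close> \<open>x \<in> S\<close>]
      by eventually_elim auto
    then obtain d where d: "d > 0" and
      ball: "\<And>y. dist y x < d \<Longrightarrow> y \<in> S \<and> dist (P v w y) (P v w x) < e / 2 \<and> dist (P w v y) (P w v x) < e / 2"
      unfolding eventually_nhds_metric by blast
    \<comment> \<open>Small enough that the parallelogram with sides \<open>h *\<^sub>R v\<close>
      and \<open>h *\<^sub>R w\<close> stays within distance \<open>d\<close> of \<open>x\<close>;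
      the summand 1 keeps the denominator positive if both vectors vanish.\<close>
    define h where "h = d / (norm v + norm w + 1)"
    have "h > 0" using d by (simp add: h_def add_nonneg_pos)
    have close: "dist (x + s *\<^sub>R v + t *\<^sub>R w) x < d" if "s \<in> {0..h}" "t \<in> {0..h}" for s t
    proof -
      have "dist (x + s *\<^sub>R v + t *\<^sub>R w) x = norm (s *\<^sub>R v + t *\<^sub>R w)"
        by (simp add: dist_norm algebra_simps)
      also have "\<dots> \<le> s * norm v + t * norm w"
        using that norm_triangle_ineq[of "s *\<^sub>R v" "t *\<^sub>R w"] by simp
      also have "\<dots> \<le> h * norm v + h * norm w"
        using that by (intro add_mono mult_right_mono) auto
      also have "\<dots> < h * (norm v + norm w + 1)"
        using \<open>h > 0\<close> by (simp add: algebra_simps)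
      also have "\<dots> = d"
        by (simp add: h_def add_nonneg_pos less_imp_neq[symmetric])
      finally show ?thesis .
    qed
    have f1: "f differentiable (at y)" if "y \<in> S" for y
      using Ck_on_2D(1)[OF f that] .
    have f2: "(\<lambda>y. frechet_derivative f (at y) u) differentiable (at y)" if "y \<in> S" for y u
      using Ck_on_2D(2)[OF f that] .
    obtain s t where st: "s \<in> {0..h}" "t \<in> {0..h}"
      "(f (x + h *\<^sub>R v + h *\<^sub>R w) - f (x + h *\<^sub>R v) - f (x + h *\<^sub>R w) + f x) \<bullet> b =
         h * h * P v w (x + s *\<^sub>R v + t *\<^sub>R w)"
      unfolding P_def
      by (rule second_difference_mean_value[of h x v w S f b])
        (use \<open>h > 0\<close> close ball f1 f2 in auto)
    \<comment> \<open>Here \<open>v\<close> and \<open>w\<close> have changed places, so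
      \<open>s'\<close> is the parameter along \<open>w\<close> and \<open>t'\<close> the one along
      \<open>v\<close>.\<close>
    obtain s' t' where st': "s' \<in> {0..h}" "t' \<in> {0..h}"
      "(f (x + h *\<^sub>R w + h *\<^sub>R v) - f (x + h *\<^sub>R w) - f (x + h *\<^sub>R v) + f x) \<bullet> b =
         h * h * P w v (x + s' *\<^sub>R w + t' *\<^sub>R v)"
      unfolding P_def
    proof (rule second_difference_mean_value[of h x w v S f b])
      show "x + s *\<^sub>R w + t *\<^sub>R v \<in> S" if "s \<in> {0..h}" "t \<in> {0..h}" for s t
        using ball[OF close[OF that(2,1)]] by (simp add: algebra_simps)
    qed (use \<open>h > 0\<close> f1 f2 in auto)
    have "h * h * P v w (x + s *\<^sub>R v + t *\<^sub>R w) = h * h * P w v (x + t' *\<^sub>R v + s' *\<^sub>R w)"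
      using st(3) st'(3) by (simp add: algebra_simps)
    then have "P v w (x + s *\<^sub>R v + t *\<^sub>R w) = P w v (x + t' *\<^sub>R v + s' *\<^sub>R w)"
      using \<open>h > 0\<close> by simp
    then show ?thesis
      using ball[OF close[OF st(1,2)]] ball[OF close[OF st'(2,1)]]
      by (auto simp: dist_real_def abs_if split: if_splits)
  qed
  \<comment> \<open>If the difference were nonzero, its own absolute value could be taken as the
    bound \<open>e\<close>, and it would be smaller than itself.\<close>
  from this[of "\<bar>P v w x - P w v x\<bar>"] have "P v w x = P w v x" by force
  then show "frechet_derivative (\<lambda>y. frechet_derivative f (at y) v) (at x) w \<bullet> b =
      frechet_derivative (\<lambda>y. frechet_derivative f (at y) w) (at x) v \<bullet> b"
    by (simp add: P_def)
qed

subsection \<open>Forms on open sets\<close>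

lemma frechet_derivative_eqI:
  "(f has_derivative f') (at x) \<Longrightarrow> frechet_derivative f (at x) = f'"
  using frechet_derivative_at by metis

text \<open>Near \<open>x\<close> both functions satisfy \<open>has_derivative\<close> for the same
  linear maps, and \<open>frechet_derivative\<close> is a choice among these. Hence the equality
  also covers points where neither function is differentiable.\<close>

lemma frechet_derivative_cong_open:
  assumes "open S" "x \<in> S" "\<And>y. y \<in> S \<Longrightarrow> f y = g y"
  shows "frechet_derivative f (at x) = frechet_derivative g (at x)"
proof -
  have "(f has_derivative D) (at x) \<longleftrightarrow> (g has_derivative D) (at x)" for D
    using has_derivative_transform_within_open[of f D x UNIV S g]
      has_derivative_transform_within_open[of g D x UNIV S f] assms by auto
  then show ?thesis by (simp add: frechet_derivative_def)
qed

text \<open>A combined chain and product rule in which the base point and both arguments move. In a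
  basis it becomes a finite sum of products of real functions.\<close>

lemma has_derivative_bilinear_family:
  fixes G :: "'y::euclidean_space \<Rightarrow> 'a::euclidean_space \<Rightarrow> 'b::euclidean_space \<Rightarrow> real"
    and \<phi> :: "'x::euclidean_space \<Rightarrow> 'y"
  assumes S: "open S" "x \<in> S" "\<phi> ` S \<subseteq> V" and V: "open V"
    and bil: "\<And>y. y \<in> V \<Longrightarrow> bilinear (G y)"
    and G: "\<And>a b. (\<lambda>y. G y a b) differentiable (at (\<phi> x))"
    and \<phi>: "(\<phi> has_derivative \<phi>') (at x)"
    and \<alpha>: "(\<alpha> has_derivative \<alpha>') (at x)" and \<beta>: "(\<beta> has_derivative \<beta>') (at x)"
  shows "((\<lambda>s. G (\<phi> s) (\<alpha> s) (\<beta> s)) has_derivative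
     (\<lambda>h. frechet_derivative (\<lambda>y. G y (\<alpha> x) (\<beta> x)) (at (\<phi> x)) (\<phi>' h) +
          G (\<phi> x) (\<alpha>' h) (\<beta> x) + G (\<phi> x) (\<alpha> x) (\<beta>' h))) (at x)"
proof -
  define D where "D i j = frechet_derivative (\<lambda>y. G y i j) (at (\<phi> x))" for i j
  have D: "((\<lambda>y. G y i j) has_derivative D i j) (at (\<phi> x))" for i j
    using G by (simp add: D_def frechet_derivative_works)
  have \<phi>x: "\<phi> x \<in> V" using S by auto
  \<comment> \<open>The basis expansion of \<open>G y a b\<close> holds on the open set
    \<open>V\<close> and not just at one point, so it may be differentiated in
    \<open>y\<close>.\<close>
  have D_sum: "frechet_derivative (\<lambda>y. G y a b) (at (\<phi> x)) k =
      (\<Sum>i\<in>Basis. \<Sum>j\<in>Basis. (a \<bullet> i) * (b \<bullet> j) * D i j k)" for a b k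
  proof -
    have "frechet_derivative (\<lambda>y. G y a b) (at (\<phi> x)) =
        frechet_derivative (\<lambda>y. \<Sum>i\<in>Basis. \<Sum>j\<in>Basis. (a \<bullet> i) * (b \<bullet> j) * G y i j) (at (\<phi> x))"
      using V \<phi>x bilinear_expand[OF bil] by (rule frechet_derivative_cong_open)
    also have "\<dots> = (\<lambda>k. \<Sum>i\<in>Basis. \<Sum>j\<in>Basis. (a \<bullet> i) * (b \<bullet> j) * D i j k)"
      by (intro frechet_derivative_eqI has_derivative_sum has_derivative_mult_right D)
    finally show ?thesis by simp
  qed
  have "((\<lambda>s. \<Sum>i\<in>Basis. \<Sum>j\<in>Basis. (\<alpha> s \<bullet> i) * (\<beta> s \<bullet> j) * G (\<phi> s) i j) has_derivative
     (\<lambda>h. \<Sum>i\<in>Basis. \<Sum>j\<in>Basis. (\<alpha> x \<bullet> i) * (\<beta> x \<bullet> j) * D i j (\<phi>' h) +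
        ((\<alpha> x \<bullet> i) * (\<beta>' h \<bullet> j) + (\<alpha>' h \<bullet> i) * (\<beta> x \<bullet> j)) * G (\<phi> x) i j)) (at x)"
    by (intro has_derivative_sum has_derivative_mult has_derivative_inner_left \<alpha> \<beta>
        has_derivative_compose[OF \<phi> D])
  also have "(\<lambda>h. \<Sum>i\<in>Basis. \<Sum>j\<in>Basis. (\<alpha> x \<bullet> i) * (\<beta> x \<bullet> j) * D i j (\<phi>' h) +
        ((\<alpha> x \<bullet> i) * (\<beta>' h \<bullet> j) + (\<alpha>' h \<bullet> i) * (\<beta> x \<bullet> j)) * G (\<phi> x) i j) =
     (\<lambda>h. frechet_derivative (\<lambda>y. G y (\<alpha> x) (\<beta> x)) (at (\<phi> x)) (\<phi>' h) +
          G (\<phi> x) (\<alpha>' h) (\<beta> x) + G (\<phi> x) (\<alpha> x) (\<beta>' h))"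
    by (simp add: fun_eq_iff D_sum bilinear_expand[OF bil[OF \<phi>x], of "\<alpha>' _" "\<beta> x"]
        bilinear_expand[OF bil[OF \<phi>x], of "\<alpha> x" "\<beta>' _"] distrib_right sum.distrib)
  finally show ?thesis
  proof (rule has_derivative_transform_within_open[OF _ S(1,2)])
    fix s assume "s \<in> S"
    then show "(\<Sum>i\<in>Basis. \<Sum>j\<in>Basis. (\<alpha> s \<bullet> i) * (\<beta> s \<bullet> j) * G (\<phi> s) i j) =
        G (\<phi> s) (\<alpha> s) (\<beta> s)"
      using S(3) by (subst bilinear_expand[OF bil, of _ "\<alpha> s"]) auto
  qed
qed

section \<open>Exterior derivatives and wedge products in coordinates\<close>

lemma flat_ext_deriv_1:
  "flat_ext_deriv f x [u, v] =
     frechet_derivative (\<lambda>y. f y [v]) (at x) u - frechet_derivative (\<lambda>y. f y [u]) (at x) v"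
  by (simp add: flat_ext_deriv_def lessThan_Suc)

lemma flat_ext_deriv_2:
  "flat_ext_deriv f x [u, v, w] =
     frechet_derivative (\<lambda>y. f y [v, w]) (at x) u - frechet_derivative (\<lambda>y. f y [u, w]) (at x) v +
     frechet_derivative (\<lambda>y. f y [u, v]) (at x) w"
  by (simp add: flat_ext_deriv_def lessThan_Suc numeral_2_eq_2)

text \<open>Naturality of the exterior derivative. Differentiating a pullback also produces terms
  with second derivatives of \<open>\<phi>\<close>; in the alternating sum these cancel, by symmetry
  of second derivatives and antisymmetry of \<open>g\<close>.\<close>

lemma flat_ext_deriv_pullback_2:
  fixes \<phi> :: "'e::euclidean_space \<Rightarrow> 'f::euclidean_space"
  assumes U: "open U" "x \<in> U" "\<phi> ` U \<subseteq> V" and V: "open V"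
    and \<phi>: "Ck_on 2 U \<phi>"
    and bil: "\<And>y. y \<in> V \<Longrightarrow> bilinear (\<lambda>a b. g y [a, b])"
    and anti: "\<And>y a b. y \<in> V \<Longrightarrow> g y [a, b] = - g y [b, a]"
    and g: "\<And>a b. (\<lambda>y. g y [a, b]) differentiable (at (\<phi> x))"
    and f: "\<And>y a b. y \<in> U \<Longrightarrow>
      f y [a, b] = g (\<phi> y) [frechet_derivative \<phi> (at y) a, frechet_derivative \<phi> (at y) b]"
  shows "flat_ext_deriv f x [u, v, w] =
    flat_ext_deriv g (\<phi> x) (map (frechet_derivative \<phi> (at x)) [u, v, w])"
proof -
  let ?d = "\<lambda>y. frechet_derivative \<phi> (at y)"
  define H where "H a c = frechet_derivative (\<lambda>y. ?d y a) (at x) c" for a c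
  have d\<phi>: "(\<phi> has_derivative ?d x) (at x)"
    using Ck_on_2D(1)[OF \<phi> U(2)] by (simp add: frechet_derivative_works)
  have dd: "((\<lambda>y. ?d y a) has_derivative H a) (at x)" for a
    using Ck_on_2D(2)[OF \<phi> U(2)] unfolding H_def by (simp add: frechet_derivative_works)
  have D: "frechet_derivative (\<lambda>y. f y [a, b]) (at x) =
      (\<lambda>h. frechet_derivative (\<lambda>y. g y [?d x a, ?d x b]) (at (\<phi> x)) (?d x h) +
          g (\<phi> x) [H a h, ?d x b] + g (\<phi> x) [?d x a, H b h])" for a b
  proof -
    have "frechet_derivative (\<lambda>y. f y [a, b]) (at x) =
        frechet_derivative (\<lambda>s. g (\<phi> s) [?d s a, ?d s b]) (at x)"
      using U(1,2) by (rule frechet_derivative_cong_open) (rule f)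
    also have "\<dots> = (\<lambda>h. frechet_derivative (\<lambda>y. g y [?d x a, ?d x b]) (at (\<phi> x)) (?d x h) +
          g (\<phi> x) [H a h, ?d x b] + g (\<phi> x) [?d x a, H b h])"
      by (rule frechet_derivative_eqI, rule has_derivative_bilinear_family[where
          G = "\<lambda>y a b. g y [a, b]", OF U V bil g d\<phi> dd dd])
    finally show ?thesis .
  qed
  have H: "H a b = H b a" for a b
    unfolding H_def by (rule second_derivative_symmetric[OF U(1,2) \<phi>])
  have "\<phi> x \<in> V" using U by auto
  then show ?thesis
    unfolding flat_ext_deriv_2 D list.map H[of v u] H[of w u] H[of w v]
    using anti[of "\<phi> x" "?d x v" "H u w"] anti[of "\<phi> x" "?d x w" "H u v"]
      anti[of "\<phi> x" "?d x u" "H v w"] by linarith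
qed

text \<open>The coordinate version of 0 = d(dw) = db \<and> w - b \<and> dw together with b \<and>
  dw = b \<and> b \<and> w = 0. The equation \<open>eq\<close> is assumed on all of \<open>U\<close>
  because it gets differentiated.\<close>

lemma flat_conformal_wedge:
  fixes w :: "'e::euclidean_space \<Rightarrow> 'e list \<Rightarrow> real"
  assumes U: "open U" "x \<in> U"
    and w: "\<And>p q. Ck_on 2 U (\<lambda>y. w y [p, q])"
    and b: "\<And>p. Ck_on 2 U (\<lambda>y. b y [p])"
    and eq: "\<And>y p q r. y \<in> U \<Longrightarrow> flat_ext_deriv w y [p, q, r] =
       b y [p] * w y [q, r] - b y [q] * w y [p, r] + b y [r] * w y [p, q]"
  shows "flat_ext_deriv b x [p, q] * w x [r, s] - flat_ext_deriv b x [p, r] * w x [q, s]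
       + flat_ext_deriv b x [p, s] * w x [q, r] + flat_ext_deriv b x [q, r] * w x [p, s]
       - flat_ext_deriv b x [q, s] * w x [p, r] + flat_ext_deriv b x [r, s] * w x [p, q] = 0"
proof -
  define W where "W p q = frechet_derivative (\<lambda>y. w y [p, q]) (at x)" for p q
  define B where "B p = frechet_derivative (\<lambda>y. b y [p]) (at x)" for p
  define Q where "Q p q h = frechet_derivative
    (\<lambda>y. frechet_derivative (\<lambda>y. w y [p, q]) (at y) h) (at x)" for p q h
  have W: "((\<lambda>y. w y [p, q]) has_derivative W p q) (at x)" for p q
    using Ck_on_2D(1)[OF w U(2)] by (simp add: W_def frechet_derivative_works)
  have B: "((\<lambda>y. b y [p]) has_derivative B p) (at x)" for p
    using Ck_on_2D(1)[OF b U(2)] by (simp add: B_def frechet_derivative_works)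
  have Q: "((\<lambda>y. frechet_derivative (\<lambda>y. w y [p, q]) (at y) h) has_derivative Q p q h) (at x)"
    for p q h
    using Ck_on_2D(2)[OF w U(2)] by (simp add: Q_def frechet_derivative_works)
  have Q_sym: "Q p q h k = Q p q k h" for p q h k
    unfolding Q_def by (rule second_derivative_symmetric[OF U w])
  \<comment> \<open>The derivative of \<open>eq\<close> in direction \<open>s\<close>: second
    derivatives of \<open>w\<close> on the left, the product rule on the right.\<close>
  have d_eq: "Q q r p s - Q p r q s + Q p q r s =
      (b x [p] * W q r s + B p s * w x [q, r]) - (b x [q] * W p r s + B q s * w x [p, r])
      + (b x [r] * W p q s + B r s * w x [p, q])" for p q r s
  proof -
    have "((\<lambda>y. flat_ext_deriv w y [p, q, r]) has_derivative
        (\<lambda>s. Q q r p s - Q p r q s + Q p q r s)) (at x)"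
      unfolding flat_ext_deriv_2 by (intro has_derivative_add has_derivative_diff Q)
    then have 1: "frechet_derivative (\<lambda>y. flat_ext_deriv w y [p, q, r]) (at x) =
        (\<lambda>s. Q q r p s - Q p r q s + Q p q r s)"
      by (rule frechet_derivative_eqI)
    have "((\<lambda>y. b y [p] * w y [q, r] - b y [q] * w y [p, r] + b y [r] * w y [p, q]) has_derivative
        (\<lambda>s. (b x [p] * W q r s + B p s * w x [q, r]) - (b x [q] * W p r s + B q s * w x [p, r])
      + (b x [r] * W p q s + B r s * w x [p, q]))) (at x)"
      by (intro has_derivative_add has_derivative_diff has_derivative_mult W B)
    then have 2: "frechet_derivative (\<lambda>y. b y [p] * w y [q, r] - b y [q] * w y [p, r] +
        b y [r] * w y [p, q]) (at x) =
        (\<lambda>s. (b x [p] * W q r s + B p s * w x [q, r]) - (b x [q] * W p r s + B q s * w x [p, r])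
      + (b x [r] * W p q s + B r s * w x [p, q]))"
      by (rule frechet_derivative_eqI)
    have "frechet_derivative (\<lambda>y. flat_ext_deriv w y [p, q, r]) (at x) =
        frechet_derivative (\<lambda>y. b y [p] * w y [q, r] - b y [q] * w y [p, r] +
        b y [r] * w y [p, q]) (at x)"
      using U by (rule frechet_derivative_cong_open) (rule eq)
    from this[unfolded 1 2] show ?thesis
      by (rule fun_cong)
  qed
  have eqx: "W q r p - W p r q + W p q r =
      b x [p] * w x [q, r] - b x [q] * w x [p, r] + b x [r] * w x [p, q]" for p q r
    using eq[OF U(2), of p q r] by (simp add: flat_ext_deriv_2 W_def)
  \<comment> \<open>With \<open>c\<close> a value of \<open>b\<close>, these products are the terms
    of b \<and> dw. Multiplying beforehand leaves only linear arithmetic for the final step.\<close>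
  have mul: "c * (W q r p - W p r q + W p q r) =
      c * (b x [p] * w x [q, r] - b x [q] * w x [p, r] + b x [r] * w x [p, q])" for p q r c
    by (simp add: eqx)
  \<comment> \<open>Each of the four instances of \<open>d_eq\<close> uses one of \<open>p\<close>,
    \<open>q\<close>, \<open>r\<close>, \<open>s\<close> as the direction and the others as
    arguments. Their alternating sum is d(dw), whose second derivatives cancel by
    \<open>Q_sym\<close>; the instances of \<open>mul\<close> eliminate the first derivatives of
    \<open>w\<close>.\<close>
  show ?thesis
    using d_eq[of r s q p] d_eq[of r s p q] d_eq[of q s p r] d_eq[of q r p s]
      mul[of "b x [p]" r s q] mul[of "b x [q]" r s p] mul[of "b x [r]" q s p] mul[of "b x [s]" q r p]
      Q_sym[of r s q p] Q_sym[of q s r p] Q_sym[of q r s p]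
      Q_sym[of p s r q] Q_sym[of p r s q] Q_sym[of p q s r]
    unfolding flat_ext_deriv_1 B_def[symmetric]
    by (simp add: algebra_simps)
qed

text \<open>Linearity of \<open>b y\<close> holds for all \<open>y\<close> near \<open>x\<close>, so
  it passes to the derivative in the base point. This makes db at \<open>x\<close> a bilinear form
  to which the linear algebra applies.\<close>

lemma bilinear_flat_ext_deriv_1:
  assumes U: "open U" "x \<in> U"
    and lin: "\<And>y. y \<in> U \<Longrightarrow> linear (\<lambda>a. b y [a])"
    and diff: "\<And>a. (\<lambda>y. b y [a]) differentiable (at x)"
  shows "bilinear (\<lambda>u v. flat_ext_deriv b x [u, v])"
proof -
  define B where "B p = frechet_derivative (\<lambda>y. b y [p]) (at x)" for p
  have B: "((\<lambda>y. b y [p]) has_derivative B p) (at x)" for p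
    using diff by (simp add: B_def frechet_derivative_works)
  have "linear (B p)" for p
    using diff unfolding B_def by (rule linear_frechet_derivative)
  note lin_B = linear_add[OF this] linear_scale[OF this]
  have "B (p + q) = (\<lambda>h. B p h + B q h)" for p q
  proof -
    have "B (p + q) = frechet_derivative (\<lambda>y. b y [p] + b y [q]) (at x)"
      unfolding B_def using U by (rule frechet_derivative_cong_open) (rule linear_add[OF lin])
    also have "\<dots> = (\<lambda>h. B p h + B q h)"
      by (intro frechet_derivative_eqI has_derivative_add B)
    finally show ?thesis .
  qed
  moreover have "B (k *\<^sub>R p) = (\<lambda>h. k *\<^sub>R B p h)" for k p
  proof -
    have "B (k *\<^sub>R p) = frechet_derivative (\<lambda>y. k *\<^sub>R b y [p]) (at x)"
      unfolding B_def using U by (rule frechet_derivative_cong_open) (rule linear_scale[OF lin])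
    also have "\<dots> = (\<lambda>h. k *\<^sub>R B p h)"
      by (intro frechet_derivative_eqI has_derivative_scaleR_right B)
    finally show ?thesis .
  qed
  ultimately show ?thesis
    unfolding flat_ext_deriv_1 B_def[symmetric] bilinear_def
    by (intro conjI allI linearI) (simp_all add: lin_B right_diff_distrib)
qed

text \<open>The six permutations pair off by exchanging the two arguments of
  \<open>\<omega>\<close>, and equal terms in a pair absorb the factor 1/2. Antisymmetry is asked
  for these three vectors only, since a form is alternating just on tangent vectors.\<close>

lemma wedge_1_2:
  assumes "\<And>X Y. {X, Y} \<subseteq> {X1, X2, X3} \<Longrightarrow> \<omega> q [X, Y] = - \<omega> q [Y, X]"
  shows "wedge 1 2 \<beta> \<omega> q [X1, X2, X3] =
    \<beta> q [X1] * \<omega> q [X2, X3] - \<beta> q [X2] * \<omega> q [X1, X3] + \<beta> q [X3] * \<omega> q [X1, X2]"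
proof -
  have set: "{..<1 + 2 :: nat} = {0, 1, 2}" by auto
  have f012: "finite {1, 2 :: nat}" "0 \<notin> {1, 2 :: nat}" by auto
  have f12: "finite {2 :: nat}" "1 \<notin> {2 :: nat}" by auto
  have upt: "[0..<1] = [0::nat]" "[1..<1 + 2] = [1, 2::nat]" by (auto simp: upt_rec)
  have anti: "\<omega> q [X2, X1] = - \<omega> q [X1, X2]" "\<omega> q [X3, X1] = - \<omega> q [X1, X3]"
      "\<omega> q [X3, X2] = - \<omega> q [X2, X3]"
    using assms[of X2 X1] assms[of X3 X1] assms[of X3 X2] by auto
  show ?thesis
    unfolding wedge_def set upt sum_over_permutations_insert[OF f012]
      sum_over_permutations_insert[OF f12] permutes_sing
    by (simp add: sign_swap_id permutation_swap_id sign_compose sign_id swap_id_eq, simp add: anti)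
qed

subsection \<open>Forms in charts\<close>

lemma chart_onD:
  assumes "chart_on M c"
  shows "open (chart_map c ` chart_dom c)" "inj_on (chart_map c) (chart_dom c)"
    "chart_dom c \<subseteq> topspace M"
    "\<And>q. q \<in> chart_dom c \<Longrightarrow> chart_inv c (chart_map c q) = q"
    "\<And>q. q \<in> chart_dom c \<Longrightarrow> transition c c' (chart_map c q) = chart_map c' q"
proof -
  show "open (chart_map c ` chart_dom c)"
    using assms by (simp add: chart_on_def)
  show sub: "chart_dom c \<subseteq> topspace M"
    using assms by (simp add: chart_on_def openin_subset)
  have "homeomorphic_map (subtopology M (chart_dom c))
       (top_of_set (chart_map c ` chart_dom c)) (chart_map c)"
    using assms by (simp add: chart_on_def)
  from homeomorphic_imp_injective_map[OF this]
  show inj: "inj_on (chart_map c) (chart_dom c)"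
    using sub by (simp add: Int_absorb1)
  show "chart_inv c (chart_map c q) = q" if "q \<in> chart_dom c" for q
    using inj that by (simp add: chart_inv_def)
  then show "transition c c' (chart_map c q) = chart_map c' q" if "q \<in> chart_dom c" for q
    using that by (simp add: transition_def)
qed

text \<open>A chart map is open onto its image, which is itself open. Overlaps can thus serve as
  neighbourhoods on which transition maps are differentiated.\<close>

lemma open_chart_overlap:
  assumes "chart_on M c" "chart_on M c'"
  shows "open (chart_map c ` (chart_dom c \<inter> chart_dom c'))"
proof -
  have "openin (subtopology M (chart_dom c)) (chart_dom c \<inter> chart_dom c')"
    using assms by (auto simp: chart_on_def openin_subtopology)
  moreover have "open_map (subtopology M (chart_dom c))
       (top_of_set (chart_map c ` chart_dom c)) (chart_map c)"
    using assms(1) by (intro homeomorphic_imp_open_map) (simp add: chart_on_def)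
  ultimately have "openin (top_of_set (chart_map c ` chart_dom c))
      (chart_map c ` (chart_dom c \<inter> chart_dom c'))"
    by (simp add: open_map_def)
  then show ?thesis
    using assms(1) openin_open_trans by (auto simp: chart_on_def)
qed

lemma charts_atD:
  assumes "c \<in> charts_at A q"
  shows "c \<in> A" "q \<in> chart_dom c"
  using assms by (auto simp: charts_at_def)

section \<open>Transition maps and their differentials\<close>

context
  fixes M :: "'a topology" and A :: "('a, 'e::euclidean_space) chart set"
  assumes M: "smooth_manifold M A"
begin

lemma chart_on_atlas: "c \<in> A \<Longrightarrow> chart_on M c"
  using M by (simp add: smooth_manifold_def)

lemma topspace_eq_chart_doms: "topspace M = (\<Union>c\<in>A. chart_dom c)"
  using M by (simp add: smooth_manifold_def)

lemma smooth_transition: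
  "c \<in> A \<Longrightarrow> c' \<in> A \<Longrightarrow>
    smooth_on (chart_map c ` (chart_dom c \<inter> chart_dom c')) (transition c c')"
  using M by (simp add: smooth_manifold_def)

lemma transition_has_derivative:
  assumes "c \<in> charts_at A q" "c' \<in> charts_at A q"
  shows "(transition c c' has_derivative frechet_derivative (transition c c') (at (chart_map c q)))
           (at (chart_map c q))"
proof -
  have "Ck_on 2 (chart_map c ` (chart_dom c \<inter> chart_dom c')) (transition c c')"
    using smooth_transition charts_atD[OF assms(1)] charts_atD[OF assms(2)]
    by (simp add: smooth_on_def)
  moreover have "chart_map c q \<in> chart_map c ` (chart_dom c \<inter> chart_dom c')"
    using assms by (auto simp: charts_at_def)
  ultimately show ?thesis
    using Ck_on_2D(1) frechet_derivative_works by blast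
qed

lemma linear_transition_derivative:
  assumes "c \<in> charts_at A q" "c' \<in> charts_at A q"
  shows "linear (frechet_derivative (transition c c') (at (chart_map c q)))"
  using transition_has_derivative[OF assms] by (rule has_derivative_linear)

lemma transition_derivative_self:
  assumes "c \<in> charts_at A q"
  shows "frechet_derivative (transition c c) (at (chart_map c q)) v = v"
proof -
  note c = charts_atD[OF assms]
  note chart = chart_onD[OF chart_on_atlas[OF c(1)]]
  have "frechet_derivative (transition c c) (at (chart_map c q)) =
      frechet_derivative (\<lambda>y. y) (at (chart_map c q))"
    using chart(1,5) c(2) by (intro frechet_derivative_cong_open[of "chart_map c ` chart_dom c"]) auto
  then show ?thesis by simp
qed

text \<open>The cocycle rule: the chain rule for the factorisation through \<open>c'\<close>, which
  is valid on the open overlap of \<open>c\<close> and \<open>c'\<close>.\<close>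

lemma transition_derivative_compose:
  assumes "c \<in> charts_at A q" "c' \<in> charts_at A q" "c'' \<in> charts_at A q"
  shows "frechet_derivative (transition c c'') (at (chart_map c q)) v =
    frechet_derivative (transition c' c'') (at (chart_map c' q))
      (frechet_derivative (transition c c') (at (chart_map c q)) v)"
proof -
  note c = charts_atD[OF assms(1)] and c' = charts_atD[OF assms(2)]
  note chart = chart_onD[OF chart_on_atlas[OF c(1)]]
  note chart' = chart_onD[OF chart_on_atlas[OF c'(1)]]
  have "frechet_derivative (transition c c'') (at (chart_map c q)) =
      frechet_derivative (\<lambda>y. transition c' c'' (transition c c' y)) (at (chart_map c q))"
    using open_chart_overlap[OF chart_on_atlas chart_on_atlas, OF c(1) c'(1)]
    by (rule frechet_derivative_cong_open) (use c c' chart(5) chart'(5) in auto)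
  also have "\<dots> = (\<lambda>v. frechet_derivative (transition c' c'') (at (chart_map c' q))
      (frechet_derivative (transition c c') (at (chart_map c q)) v))"
    using transition_has_derivative[OF assms(2,3)] chart(5)[OF c(2)]
    by (intro frechet_derivative_eqI
        has_derivative_compose[OF transition_has_derivative[OF assms(1,2)]]) simp
  finally show ?thesis by simp
qed

section \<open>Tangent vectors and their coordinates\<close>

lemma tangent_of_in_tangent_space:
  assumes "c \<in> charts_at A q"
  shows "tangent_of A c q v \<in> tangent_space A q"
proof -
  have compatible: "tangent_of A c q v c'' =
      frechet_derivative (transition c' c'') (at (chart_map c' q)) (tangent_of A c q v c')"
    if "c' \<in> charts_at A q" "c'' \<in> charts_at A q" for c' c''
    using that transition_derivative_compose[OF assms that] by (simp only: tangent_of_def if_True)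
  show ?thesis
    unfolding tangent_space_def
    by (intro CollectI conjI ballI allI impI) (rule compatible, simp_all add: tangent_of_def)
qed

lemma tangent_of_self: "c \<in> charts_at A q \<Longrightarrow> tangent_of A c q v c = v"
  by (simp add: tangent_of_def transition_derivative_self)

text \<open>A compatible family is determined by one of its members. Together with
  \<open>tangent_of_self\<close> this identifies the tangent space with \<open>'e\<close> through
  the chart \<open>c\<close>.\<close>

lemma tangent_of_coordinate:
  assumes "c \<in> charts_at A q" "X \<in> tangent_space A q"
  shows "tangent_of A c q (X c) = X"
proof
  fix c'
  show "tangent_of A c q (X c) c' = X c'"
  proof (cases "c' \<in> charts_at A q")
    case True
    then have "X c' = frechet_derivative (transition c c') (at (chart_map c q)) (X c)"
      using assms unfolding tangent_space_def by blast
    then show ?thesis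
      using True by (simp only: tangent_of_def if_True)
  next
    \<comment> \<open>Outside the charts around \<open>q\<close> both families are 0 by
      convention.\<close>
    case False
    then show ?thesis
      using assms(2) by (simp add: tangent_of_def tangent_space_def)
  qed
qed

lemma tangent_of_change_chart:
  assumes "c \<in> charts_at A q" "c' \<in> charts_at A q"
  shows "tangent_of A c q v =
    tangent_of A c' q (frechet_derivative (transition c c') (at (chart_map c q)) v)"
proof
  fix c''
  show "tangent_of A c q v c'' =
      tangent_of A c' q (frechet_derivative (transition c c') (at (chart_map c q)) v) c''"
  proof (cases "c'' \<in> charts_at A q")
    case True
    then show ?thesis
      using transition_derivative_compose[OF assms True] by (simp only: tangent_of_def if_True)
  qed (simp add: tangent_of_def)
qed

lemma tangent_of_linear_combination:
  assumes "c \<in> charts_at A q"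
  shows "tangent_of A c q (a *\<^sub>R v + b *\<^sub>R w) =
    (\<lambda>c'. a *\<^sub>R tangent_of A c q v c' + b *\<^sub>R tangent_of A c q w c')"
  using linear_transition_derivative[OF assms]
  by (auto simp: tangent_of_def fun_eq_iff linear_add linear_scale)

section \<open>Coordinate expressions of forms\<close>

lemma local_form_eq:
  assumes "c \<in> charts_at A q"
  shows "local_form A c \<omega> (chart_map c q) vs = \<omega> q (map (tangent_of A c q) vs)"
  using chart_onD(4)[OF chart_on_atlas] charts_atD[OF assms] by (simp add: local_form_def)

lemma charts_at_subset_topspace:
  assumes "c \<in> charts_at A q"
  shows "q \<in> topspace M"
  using chart_onD(3)[OF chart_on_atlas] charts_atD[OF assms] by blast

lemma smooth_form_multilinear:
  assumes \<omega>: "smooth_form M A k \<omega>" and q: "q \<in> topspace M"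
    and "Xs \<in> tangent_lists A k q" "i < k" "X \<in> tangent_space A q" "Y \<in> tangent_space A q"
  shows "\<omega> q (Xs[i := (\<lambda>c. a *\<^sub>R X c + b *\<^sub>R Y c)]) = a * \<omega> q (Xs[i := X]) + b * \<omega> q (Xs[i := Y])"
  using assms unfolding smooth_form_def multilinear_at_def by blast

lemma smooth_form_local_Ck:
  assumes "smooth_form M A k \<omega>" "c \<in> A" "length vs = k"
  shows "Ck_on n (chart_map c ` chart_dom c) (\<lambda>x. local_form A c \<omega> x vs)"
  using assms unfolding smooth_form_def smooth_on_def by blast

lemma linear_local_form:
  assumes \<beta>: "smooth_form M A 1 \<beta>" and c: "c \<in> charts_at A q"
  shows "linear (\<lambda>v. local_form A c \<beta> (chart_map c q) [v])"
proof -
  have q: "q \<in> topspace M" using c by (rule charts_at_subset_topspace)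
  have comb: "local_form A c \<beta> (chart_map c q) [a *\<^sub>R v + b *\<^sub>R w] =
      a * local_form A c \<beta> (chart_map c q) [v] + b * local_form A c \<beta> (chart_map c q) [w]" for a b v w
    using smooth_form_multilinear[OF \<beta> q, of "[tangent_of A c q v]" 0 "tangent_of A c q v"
        "tangent_of A c q w" a b] tangent_of_in_tangent_space[OF c]
    by (simp add: local_form_eq[OF c] tangent_of_linear_combination[OF c] tangent_lists_def)
  \<comment> \<open>Coefficients 1, 1 give additivity; a second coefficient 0 gives
    homogeneity.\<close>
  show ?thesis
    using comb[of 1 _ 1] comb[of _ _ 0] by (auto intro!: linearI)
qed

lemma bilinear_local_form:
  assumes \<omega>: "smooth_form M A 2 \<omega>" and c: "c \<in> charts_at A q"
  shows "bilinear (\<lambda>v w. local_form A c \<omega> (chart_map c q) [v, w])"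
proof -
  let ?w = "\<lambda>v w. local_form A c \<omega> (chart_map c q) [v, w]"
  have q: "q \<in> topspace M" using c by (rule charts_at_subset_topspace)
  have "?w (a *\<^sub>R u + b *\<^sub>R v) w = a * ?w u w + b * ?w v w" for a b u v w
    using smooth_form_multilinear[OF \<omega> q, of "[tangent_of A c q u, tangent_of A c q w]" 0
        "tangent_of A c q u" "tangent_of A c q v" a b] tangent_of_in_tangent_space[OF c]
    unfolding tangent_of_linear_combination[OF c, symmetric]
    by (simp add: local_form_eq[OF c] tangent_lists_def)
  from this[of 1 _ 1] this[of _ _ 0] have "linear (\<lambda>v. ?w v w)" for w
    by (auto intro!: linearI)
  moreover have "?w w (a *\<^sub>R u + b *\<^sub>R v) = a * ?w w u + b * ?w w v" for a b u v w
    using smooth_form_multilinear[OF \<omega> q, of "[tangent_of A c q w, tangent_of A c q u]" 1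
        "tangent_of A c q u" "tangent_of A c q v" a b] tangent_of_in_tangent_space[OF c]
    unfolding tangent_of_linear_combination[OF c, symmetric]
    by (simp add: local_form_eq[OF c] tangent_lists_def)
  from this[of _ 1 _ 1] this[of _ _ _ 0] have "linear (?w w)" for w
    by (auto intro!: linearI)
  ultimately show ?thesis
    by (simp add: bilinear_def)
qed

lemma local_form_alternating:
  assumes \<omega>: "smooth_form M A 2 \<omega>" and c: "c \<in> charts_at A q"
  shows "local_form A c \<omega> (chart_map c q) [v, v] = 0"
proof -
  let ?X = "tangent_of A c q v"
  have "[?X, ?X] \<in> tangent_lists A 2 q"
    using tangent_of_in_tangent_space[OF c] by (simp add: tangent_lists_def)
  moreover have "\<exists>i<2. \<exists>j<2. i \<noteq> j \<and> [?X, ?X] ! i = [?X, ?X] ! j"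
    by (rule exI[of _ 0], rule conjI, simp, rule exI[of _ 1], simp)
  moreover have "alternating_at A 2 q (\<omega> q)"
    using \<omega> charts_at_subset_topspace[OF c] unfolding smooth_form_def by blast
  ultimately have "\<omega> q [?X, ?X] = 0"
    unfolding alternating_at_def by blast
  then show ?thesis
    by (simp only: local_form_eq[OF c] list.map)
qed

text \<open>Polarisation: expand the vanishing value on the pair \<open>v + w\<close>,
  \<open>v + w\<close>.\<close>

lemma local_form_antisymmetric:
  assumes \<omega>: "smooth_form M A 2 \<omega>" and c: "c \<in> charts_at A q"
  shows "local_form A c \<omega> (chart_map c q) [v, w] = - local_form A c \<omega> (chart_map c q) [w, v]"
proof -
  let ?w = "\<lambda>v w. local_form A c \<omega> (chart_map c q) [v, w]"
  note bil = bilinear_local_form[OF assms] and alt = local_form_alternating[OF assms]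
  have "?w (v + w) (v + w) = ?w v v + ?w v w + (?w w v + ?w w w)"
    by (simp only: bilinear_ladd[OF bil] bilinear_radd[OF bil] ac_simps)
  then show ?thesis
    by (simp add: alt)
qed

text \<open>\<open>ext_deriv\<close> computes in whichever chart the choice operator picks at
  \<open>q\<close>. The transition map pulls the expression of \<open>\<omega>\<close> in that chart
  back to the one in \<open>c\<close>, and the exterior derivative commutes with pullbacks.\<close>

lemma ext_deriv_2_in_chart:
  assumes \<omega>: "smooth_form M A 2 \<omega>" and c: "c \<in> charts_at A q"
  shows "ext_deriv A \<omega> q (map (tangent_of A c q) [u, v, w]) =
    flat_ext_deriv (local_form A c \<omega>) (chart_map c q) [u, v, w]"
proof -
  define c' where "c' = (SOME c. c \<in> charts_at A q)"
  have c': "c' \<in> charts_at A q" unfolding c'_def using c by (rule someI)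
  note cD = charts_atD[OF c] and c'D = charts_atD[OF c']
  note chart = chart_onD[OF chart_on_atlas[OF cD(1)]]
  note chart' = chart_onD[OF chart_on_atlas[OF c'D(1)]]
  let ?U = "chart_map c ` (chart_dom c \<inter> chart_dom c')" and ?V = "chart_map c' ` chart_dom c'"
  let ?\<phi> = "transition c c'"
  have "flat_ext_deriv (local_form A c \<omega>) (chart_map c q) [u, v, w] =
    flat_ext_deriv (local_form A c' \<omega>) (?\<phi> (chart_map c q))
      (map (frechet_derivative ?\<phi> (at (chart_map c q))) [u, v, w])"
  proof (rule flat_ext_deriv_pullback_2)
    show "open ?U" using open_chart_overlap chart_on_atlas cD c'D by blast
    show "chart_map c q \<in> ?U" using cD c'D by blast
    show "?\<phi> ` ?U \<subseteq> ?V" using chart(5) by auto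
    show "open ?V" by (rule chart')
    show "Ck_on 2 ?U ?\<phi>" using smooth_transition cD c'D by (simp add: smooth_on_def)
    have V: "\<exists>p. c' \<in> charts_at A p \<and> y = chart_map c' p" if "y \<in> ?V" for y
      using that c'D(1) by (auto simp: charts_at_def)
    show "bilinear (\<lambda>a b. local_form A c' \<omega> y [a, b])" if "y \<in> ?V" for y
      using V[OF that] bilinear_local_form[OF \<omega>] by blast
    show "local_form A c' \<omega> y [a, b] = - local_form A c' \<omega> y [b, a]" if "y \<in> ?V" for y a b
      using V[OF that] local_form_antisymmetric[OF \<omega>] by blast
    show "(\<lambda>y. local_form A c' \<omega> y [a, b]) differentiable (at (?\<phi> (chart_map c q)))" for a b
      using Ck_on_2D(1)[OF smooth_form_local_Ck[OF \<omega> c'D(1)]] c'D chart(5)[OF cD(2)] by simp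
    show "local_form A c \<omega> y [a, b] = local_form A c' \<omega> (?\<phi> y)
        [frechet_derivative ?\<phi> (at y) a, frechet_derivative ?\<phi> (at y) b]" if "y \<in> ?U" for y a b
    proof -
      obtain p where p: "p \<in> chart_dom c" "p \<in> chart_dom c'" "y = chart_map c p"
        using \<open>y \<in> ?U\<close> by auto
      then have cp: "c \<in> charts_at A p" "c' \<in> charts_at A p"
        using cD c'D by (auto simp: charts_at_def)
      show ?thesis
        unfolding p(3) chart(5)[OF p(1)] local_form_eq[OF cp(1)] local_form_eq[OF cp(2)] list.map
          tangent_of_change_chart[OF cp] ..
    qed
  qed
  also have "\<dots> = ext_deriv A \<omega> q (map (tangent_of A c q) [u, v, w])"
    using c' chart(5)[OF cD(2)] by (simp add: ext_deriv_def tangent_of_def flip: c'_def)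
  finally show ?thesis by simp
qed

lemma wedge_1_2_in_chart:
  assumes \<omega>: "smooth_form M A 2 \<omega>" and c: "c \<in> charts_at A q"
  shows "wedge 1 2 \<beta> \<omega> q (map (tangent_of A c q) [u, v, w]) =
    local_form A c \<beta> (chart_map c q) [u] * local_form A c \<omega> (chart_map c q) [v, w] -
    local_form A c \<beta> (chart_map c q) [v] * local_form A c \<omega> (chart_map c q) [u, w] +
    local_form A c \<beta> (chart_map c q) [w] * local_form A c \<omega> (chart_map c q) [u, v]"
proof -
  let ?T = "tangent_of A c q"
  have anti: "\<omega> q [?T a, ?T b] = - \<omega> q [?T b, ?T a]" for a b
    using local_form_antisymmetric[OF assms, of a b] by (simp only: local_form_eq[OF c] list.map)
  show ?thesis
    unfolding list.map local_form_eq[OF c]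
  proof (rule wedge_1_2)
    fix X Y assume "{X, Y} \<subseteq> {?T u, ?T v, ?T w}"
    then obtain a b where "X = ?T a" "Y = ?T b" by blast
    then show "\<omega> q [X, Y] = - \<omega> q [Y, X]" using anti by blast
  qed
qed

text \<open>Evaluation at \<open>c\<close> carries the kernel into a line or to 0. The spanning
  vector is the coordinate vector \<open>X c\<close> of a generator \<open>X\<close>, with
  \<open>X\<close> zero in even dimension.\<close>

lemma local_kernel:
  assumes rank: "maximal_rank M A \<omega>" and c: "c \<in> charts_at A q"
  shows "\<exists>z. {v. \<forall>w. local_form A c \<omega> (chart_map c q) [v, w] = 0} \<subseteq> span {z}"
proof -
  have q: "q \<in> topspace M" using c by (rule charts_at_subset_topspace)
  have ker: "tangent_of A c q v \<in> form_kernel A \<omega> q"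
    if "\<And>w. local_form A c \<omega> (chart_map c q) [v, w] = 0" for v
  proof -
    \<comment> \<open>Every tangent vector \<open>Y\<close> arises from its coordinate vector
      \<open>Y c\<close>, so testing against coordinate vectors suffices.\<close>
    have "\<omega> q [tangent_of A c q v, Y] = 0" if "Y \<in> tangent_space A q" for Y
      using \<open>\<And>w. local_form A c \<omega> (chart_map c q) [v, w] = 0\<close>[of "Y c"]
      by (simp add: local_form_eq[OF c] tangent_of_coordinate[OF c that])
    then show ?thesis
      using tangent_of_in_tangent_space[OF c] by (simp add: form_kernel_def)
  qed
  obtain X :: "('a, 'e) tangent" where X: "form_kernel A \<omega> q \<subseteq> range (\<lambda>a c. a *\<^sub>R X c)"
  proof (cases "even DIM('e)")
    case True
    then have "form_kernel A \<omega> q \<subseteq> range (\<lambda>a c. a *\<^sub>R (\<lambda>c. 0 :: 'e) c)"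
      using rank q by (simp add: maximal_rank_def)
    then show ?thesis by (rule that)
  next
    case False
    then show ?thesis using rank q that unfolding maximal_rank_def by fastforce
  qed
  have "v \<in> span {X c}" if zero: "\<And>w. local_form A c \<omega> (chart_map c q) [v, w] = 0" for v
  proof -
    obtain a where "tangent_of A c q v = (\<lambda>c. a *\<^sub>R X c)"
      using ker[OF zero] X by blast
    then have "v = a *\<^sub>R X c"
      using tangent_of_self[OF c, of v] by simp
    then show ?thesis by (simp add: span_base span_scale)
  qed
  then show ?thesis by blast
qed

end

theorem corollary3:
  fixes M :: "'a topology"
    and A :: "('a, 'e::euclidean_space) chart set"
    and \<omega> \<beta> :: "('a, 'e) form"
  assumes "smooth_manifold M A"
    and "DIM('e) \<ge> 6"
    and "smooth_form M A 2 \<omega>"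
    and "maximal_rank M A \<omega>"
    and "smooth_form M A 1 \<beta>"
    and "form_eq M A 3 (ext_deriv A \<omega>) (wedge 1 2 \<beta> \<omega>)"
  shows "closed_form M A 1 \<beta>"
  unfolding closed_form_def form_eq_def
proof (intro ballI)
  note M = assms(1) and \<omega> = assms(3) and \<beta> = assms(5)
  fix q Xs assume q: "q \<in> topspace M" and Xs: "Xs \<in> tangent_lists A (Suc 1) q"
  \<comment> \<open>This is the very choice made by \<open>ext_deriv\<close> at \<open>q\<close>, so
    d\<beta> at \<open>q\<close> is computed in \<open>c\<close> by definition.\<close>
  define c where "c = (SOME c. c \<in> charts_at A q)"
  have "\<exists>c. c \<in> charts_at A q"
    using q topspace_eq_chart_doms[OF M] by (auto simp: charts_at_def)
  then have c: "c \<in> charts_at A q" unfolding c_def by (rule someI_ex)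
  note cD = charts_atD[OF c]
  let ?U = "chart_map c ` chart_dom c" and ?x = "chart_map c q"
  let ?w = "local_form A c \<omega>" and ?b = "local_form A c \<beta>"
  have U: "open ?U" "?x \<in> ?U"
    using chart_onD(1)[OF chart_on_atlas[OF M]] cD by auto
  have b: "Ck_on 2 ?U (\<lambda>y. ?b y [p])" for p
    using smooth_form_local_Ck[OF M \<beta> cD(1)] by simp
  \<comment> \<open>The equation is needed in the single chart \<open>c\<close> at all points of its
    image. At points other than \<open>q\<close>, \<open>ext_deriv\<close> may choose another chart,
    which is where chart independence of d\<omega> enters.\<close>
  have eq: "flat_ext_deriv ?w y [u, v, w] =
      ?b y [u] * ?w y [v, w] - ?b y [v] * ?w y [u, w] + ?b y [w] * ?w y [u, v]"
    if "y \<in> ?U" for y u v w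
  proof -
    obtain p where p: "p \<in> chart_dom c" "y = chart_map c p"
      using \<open>y \<in> ?U\<close> by auto
    then have cp: "c \<in> charts_at A p"
      using cD by (simp add: charts_at_def)
    have "map (tangent_of A c p) [u, v, w] \<in> tangent_lists A 3 p"
      using tangent_of_in_tangent_space[OF M cp] by (auto simp: tangent_lists_def)
    then have "ext_deriv A \<omega> p (map (tangent_of A c p) [u, v, w]) =
        wedge 1 2 \<beta> \<omega> p (map (tangent_of A c p) [u, v, w])"
      using assms(6) charts_at_subset_topspace[OF M cp] unfolding form_eq_def by blast
    then show ?thesis
      unfolding ext_deriv_2_in_chart[OF M \<omega> cp] wedge_1_2_in_chart[OF M \<omega> cp] p(2) .
  qed
  obtain z where z: "{v. \<forall>w. ?w ?x [v, w] = 0} \<subseteq> span {z}"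
    using local_kernel[OF M assms(4) c] by blast
  \<comment> \<open>The cancellation is applied to the bilinear forms that d\<beta> and \<omega>
    define on \<open>'e\<close> at the point \<open>?x\<close>.\<close>
  have d\<beta>: "flat_ext_deriv ?b ?x [u, v] = 0" for u v
  proof (rule wedge_two_form_cancel[OF assms(2) bilinear_local_form[OF M \<omega> c]
        local_form_alternating[OF M \<omega> c] z])
    have "linear (\<lambda>a. ?b y [a])" if "y \<in> ?U" for y
      using that linear_local_form[OF M \<beta>] cD(1) by (auto simp: charts_at_def)
    then show "bilinear (\<lambda>u v. flat_ext_deriv ?b ?x [u, v])"
      using U Ck_on_2D(1)[OF b U(2)] by (intro bilinear_flat_ext_deriv_1)
  qed (rule flat_conformal_wedge[OF U _ b eq], use smooth_form_local_Ck[OF M \<omega> cD(1)] in simp)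
  obtain X Y where "Xs = [X, Y]"
    using Xs by (auto simp: tangent_lists_def length_Suc_conv numeral_2_eq_2)
  then show "ext_deriv A \<beta> q Xs = 0"
    using d\<beta> by (simp add: ext_deriv_def flip: c_def)
qed

end
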